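(* If $f:X\to Y$ is a coarse map between metric spaces, then $f$ induces a proximity map $\nu' f:\nu' X\to\nu' Y$, $[\mathcal F]\mapsto[f_*\mathcal F]$; that is, $\pi_1\curlywedge\pi_2$ in $\nu' X$ implies $\nu' f(\pi_1)\curlywedge\nu' f(\pi_2)$ in $\nu' Y$ for all $\pi_1,\pi_2\subseteq\nu' X$.
   Context: All metrics take finite values. For a metric space $X$, an entourage is a set $E\subseteq X^2$ with $\sup_{(x,y)\in E}d(x,y)<\infty$; a subset $B\subseteq X$ is bounded if $B^2$ is an entourage; $E[A]$ denotes the set of points of $X$ that are $E$-related to some point of $A$. A map $f:X\to Y$ is coarse if $(f\times f)(E)$ is an entourage for every entourage $E\subseteq X^2$ and $f^{-1}(B)$ is bounded for every bounded $B\subseteq Y$. Subsets $A,B\subseteq X$ are coarsely disjoint, $A\not\curlywedge B$, if $E[A]\cap E[B]$ is bounded for every entourage $E$; otherwise they are close, $A\curlywedge B$. A coarse ultrafilter on $X$ is a system $\mathcal F$ of subsets of $X$ such that (1) $A,B\in\mathcal F$ implies $A\curlywedge B$; (2) if $A,B\subseteq X$ and $A\cup B\in\mathcal F$ then $A\in\mathcal F$ or $B\in\mathcal F$; (3) $X\in\mathcal F$. Two coarse ultrafilters $\mathcal F,\mathcal G$ are asymptotically alike, $\mathcal F\lambda\mathcal G$, if $A\curlywedge B$ for all $A\in\mathcal F$, $B\in\mathcal G$; this is an equivalence relation. The corona $\nu' X$ is the set of coarse ultrafilters on $X$ modulo $\lambda$. For $A\subseteq X$ let $\mathrm{cl}(A)\subseteq\nu'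 X$ be the set of classes having a representative $\mathcal F$ with $A\in\mathcal F$. For $\pi_1,\pi_2\subseteq\nu' X$ put $\pi_1\not\curlywedge\pi_2$ if there are $A,B\subseteq X$ with $A\not\curlywedge B$, $\pi_1\subseteq\mathrm{cl}(A)$, $\pi_2\subseteq\mathrm{cl}(B)$, and $\pi_1\curlywedge\pi_2$ otherwise; this is a separated proximity relation on $\nu' X$. For a coarse map $f:X\to Y$ and a coarse ultrafilter $\mathcal F$ on $X$, $f_*\mathcal F=\{A\subseteq Y:f^{-1}(A)\in\mathcal F\}$, a coarse ultrafilter on $Y$. *)

theory Defs
  imports "HOL-Analysis.Abstract_Metric_Spaces"
begin

definition entourage :: "'a metric \<Rightarrow> ('a \<times> 'a) set \<Rightarrow> bool" where
  "entourage X E \<longleftrightarrow>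
     E \<subseteq> mspace X \<times> mspace X \<and> bdd_above ((\<lambda>(x, y). mdist X x y) ` E)"

definition coarsely_bounded :: "'a metric \<Rightarrow> 'a set \<Rightarrow> bool" where
  "coarsely_bounded X B \<longleftrightarrow> entourage X (B \<times> B)"

definition coarse_map :: "'a metric \<Rightarrow> 'b metric \<Rightarrow> ('a \<Rightarrow> 'b) \<Rightarrow> bool" where
  "coarse_map X Y f \<longleftrightarrow>
     f \<in> mspace X \<rightarrow> mspace Y \<and>
     (\<forall>E. entourage X E \<longrightarrow> entourage Y (map_prod f f ` E)) \<and>
     (\<forall>B. coarsely_bounded Y B \<longrightarrow> coarsely_bounded X (f -` B \<inter> mspace X))"

text \<open>The set \<open>E[A]\<close> of points that are \<open>E\<close>-related to some point of \<open>A\<close> is \<open>E\<inverse> `` A\<close>.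
  Since entourages are closed under converse, the choice of side is immaterial below.\<close>

definition coarsely_disjoint :: "'a metric \<Rightarrow> 'a set \<Rightarrow> 'a set \<Rightarrow> bool" where
  "coarsely_disjoint X A B \<longleftrightarrow>
     (\<forall>E. entourage X E \<longrightarrow> coarsely_bounded X (E\<inverse> `` A \<inter> E\<inverse> `` B))"

abbreviation coarsely_close :: "'a metric \<Rightarrow> 'a set \<Rightarrow> 'a set \<Rightarrow> bool" where
  "coarsely_close X A B \<equiv> \<not> coarsely_disjoint X A B"

definition coarse_ultrafilters :: "'a metric \<Rightarrow> 'a set set set" where
  "coarse_ultrafilters X =
     {\<F>. \<F> \<subseteq> Pow (mspace X) \<and>
          (\<forall>A\<in>\<F>. \<forall>B\<in>\<F>. coarsely_close X A B) \<and>
          (\<forall>A B. A \<union> B \<in> \<F> \<longrightarrow> A \<in> \<F> \<or> B \<in> \<F>) \<and>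
          mspace X \<in> \<F>}"

definition asymptotically_alike :: "'a metric \<Rightarrow> ('a set set \<times> 'a set set) set" where
  "asymptotically_alike X =
     {(\<F>, \<G>). \<F> \<in> coarse_ultrafilters X \<and> \<G> \<in> coarse_ultrafilters X \<and>
              (\<forall>A\<in>\<F>. \<forall>B\<in>\<G>. coarsely_close X A B)}"

definition corona :: "'a metric \<Rightarrow> 'a set set set set" where
  "corona X = coarse_ultrafilters X // asymptotically_alike X"

abbreviation corona_class :: "'a metric \<Rightarrow> 'a set set \<Rightarrow> 'a set set set" where
  "corona_class X \<F> \<equiv> asymptotically_alike X `` {\<F>}"

definition corona_cl :: "'a metric \<Rightarrow> 'a set \<Rightarrow> 'a set set set set" where
  "corona_cl X A = {p \<in> corona X. \<exists>\<F>\<in>p. A \<in> \<F>}"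

definition corona_far :: "'a metric \<Rightarrow> 'a set set set set \<Rightarrow> 'a set set set set \<Rightarrow> bool" where
  "corona_far X P Q \<longleftrightarrow>
     (\<exists>A B. A \<subseteq> mspace X \<and> B \<subseteq> mspace X \<and> coarsely_disjoint X A B \<and>
            P \<subseteq> corona_cl X A \<and> Q \<subseteq> corona_cl X B)"

abbreviation corona_close :: "'a metric \<Rightarrow> 'a set set set set \<Rightarrow> 'a set set set set \<Rightarrow> bool" where
  "corona_close X P Q \<equiv> \<not> corona_far X P Q"

definition coarse_pushforward ::
    "'a metric \<Rightarrow> 'b metric \<Rightarrow> ('a \<Rightarrow> 'b) \<Rightarrow> 'a set set \<Rightarrow> 'b set set" where
  "coarse_pushforward X Y f \<F> = {A. A \<subseteq> mspace Y \<and> f -` A \<inter> mspace X \<in> \<F>}"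

end

theory Submission
  imports Defs
begin

text \<open>
  Close sets stay close under a coarse map, so pushing forward preserves coarse ultrafilters and
  the relation \<open>\<lambda>\<close>. The remaining ingredient is normality of coarse disjointness: if \<open>A\<close> and \<open>B\<close>
  are coarsely disjoint, comparing the distances to \<open>A\<close> and to \<open>B\<close> splits the space as \<open>C \<union> D\<close>
  with \<open>A\<close> far from \<open>C\<close> and \<open>B\<close> far from \<open>D\<close>. Any coarse ultrafilter contains \<open>C\<close> or \<open>D\<close>, which
  gives transitivity of \<open>\<lambda>\<close>. Moreover, if one representative of a class contains \<open>A\<close>, then every
  representative contains \<open>D\<close>; applying this once on each side replaces sets witnessing
  farness in the corona of \<open>Y\<close> by sets lying in the pushforwards themselves, whose preimages
  witness farness in the corona of \<open>X\<close>.
\<close>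

section \<open>Coarse disjointness: distances, normality, preimages\<close>

lemma coarsely_bounded_subset:
  assumes "coarsely_bounded X B" "A \<subseteq> B"
  shows "coarsely_bounded X A"
proof -
  have "A \<times> A \<subseteq> B \<times> B"
    using assms(2) by blast
  then show ?thesis
    using assms(1) unfolding coarsely_bounded_def entourage_def
    by (meson bdd_above_mono image_mono order_trans)
qed

lemma entourage_mdist_le:
  "entourage X {(x, y). x \<in> mspace X \<and> y \<in> mspace X \<and> mdist X x y \<le> r}"
  unfolding entourage_def by (auto intro!: bdd_aboveI[of _ r])

text \<open>Every entourage lies in some set of pairs at distance at most \<open>r\<close>, and
  these sets are entourages themselves, so they suffice as tests. Entourages live on
  \<open>mspace X\<close>, hence the intersections with it.\<close>

lemma coarsely_disjoint_metric:
  "coarsely_disjoint X A B \<longleftrightarrow>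
     (\<forall>r. coarsely_bounded X
        {x \<in> mspace X. (\<exists>a\<in>A \<inter> mspace X. mdist X x a \<le> r) \<and> (\<exists>b\<in>B \<inter> mspace X. mdist X x b \<le> r)})"
  (is "_ \<longleftrightarrow> (\<forall>r. coarsely_bounded X (?N r))")
proof
  assume disj: "coarsely_disjoint X A B"
  show "\<forall>r. coarsely_bounded X (?N r)"
  proof
    fix r
    let ?E = "{(x, y). x \<in> mspace X \<and> y \<in> mspace X \<and> mdist X x y \<le> r}"
    have "coarsely_bounded X (?E\<inverse> `` A \<inter> ?E\<inverse> `` B)"
      using disj entourage_mdist_le unfolding coarsely_disjoint_def by blast
    moreover have "?N r \<subseteq> ?E\<inverse> `` A \<inter> ?E\<inverse> `` B"
      by blast
    ultimately show "coarsely_bounded X (?N r)"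
      by (rule coarsely_bounded_subset)
  qed
next
  assume bounded: "\<forall>r. coarsely_bounded X (?N r)"
  show "coarsely_disjoint X A B"
    unfolding coarsely_disjoint_def
  proof (intro allI impI)
    fix E
    assume "entourage X E"
    then obtain r where E: "E \<subseteq> mspace X \<times> mspace X" "\<And>x y. (x, y) \<in> E \<Longrightarrow> mdist X x y \<le> r"
      unfolding entourage_def bdd_above_def by fastforce
    have "E\<inverse> `` A \<inter> E\<inverse> `` B \<subseteq> ?N r"
      using E by blast
    with bounded show "coarsely_bounded X (E\<inverse> `` A \<inter> E\<inverse> `` B)"
      using coarsely_bounded_subset by blast
  qed
qed

lemma coarsely_disjoint_sym:
  "coarsely_disjoint X A B \<longleftrightarrow> coarsely_disjoint X B A"
  unfolding coarsely_disjoint_def by (simp add: Int_commute)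

text \<open>If \<open>x\<close> is within \<open>r\<close> of both \<open>a\<close> and
  \<open>c\<close>, then \<open>c\<close> is within \<open>2 * r\<close> of \<open>a\<close>, hence
  of some \<open>b\<close>, and so \<open>x\<close> is within \<open>3 * r\<close> of
  \<open>b\<close>. Thus being near \<open>A\<close> and \<open>C\<close> forces being near
  \<open>A\<close> and \<open>B\<close>.\<close>

lemma coarsely_disjoint_of_near:
  assumes disj: "coarsely_disjoint X A B"
    and near: "\<And>c a. \<lbrakk>c \<in> C \<inter> mspace X; a \<in> A \<inter> mspace X\<rbrakk>
      \<Longrightarrow> \<exists>b\<in>B \<inter> mspace X. mdist X c b \<le> mdist X c a"
  shows "coarsely_disjoint X A C"
  unfolding coarsely_disjoint_metric
proof
  fix r
  have "\<exists>b\<in>B \<inter> mspace X. mdist X x b \<le> 3 * r"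
    if x: "x \<in> mspace X" and a: "a \<in> A \<inter> mspace X" "mdist X x a \<le> r"
      and c: "c \<in> C \<inter> mspace X" "mdist X x c \<le> r" for x a c
  proof -
    obtain b where b: "b \<in> B \<inter> mspace X" "mdist X c b \<le> mdist X c a"
      using near[OF c(1) a(1)] by blast
    have "mdist X c a \<le> mdist X c x + mdist X x a"
      using x a c by (intro Metric_space.triangle[OF Metric_space_mspace_mdist]) auto
    moreover have "mdist X x b \<le> mdist X x c + mdist X c b"
      using x b c by (intro Metric_space.triangle[OF Metric_space_mspace_mdist]) auto
    moreover have "mdist X c x = mdist X x c"
      by (rule Metric_space.commute[OF Metric_space_mspace_mdist])
    ultimately show ?thesis
      using a c b by (intro bexI[of _ b]) auto
  qed
  \<comment> \<open>Having a point within \<open>r\<close> forces \<open>r\<close> to be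
    nonnegative, so this bound may be relaxed to \<open>3 * r\<close> as well.\<close>
  moreover have "mdist X x a \<le> 3 * r" if "mdist X x a \<le> r" for x a
    using that Metric_space.nonneg[OF Metric_space_mspace_mdist, of X x a] by linarith
  ultimately have "{x \<in> mspace X. (\<exists>a\<in>A \<inter> mspace X. mdist X x a \<le> r) \<and>
                                  (\<exists>c\<in>C \<inter> mspace X. mdist X x c \<le> r)}
      \<subseteq> {x \<in> mspace X. (\<exists>a\<in>A \<inter> mspace X. mdist X x a \<le> 3 * r) \<and>
                        (\<exists>b\<in>B \<inter> mspace X. mdist X x b \<le> 3 * r)}"
    by blast
  then show "coarsely_bounded X {x \<in> mspace X. (\<exists>a\<in>A \<inter> mspace X. mdist X x a \<le> r) \<and>
                                  (\<exists>c\<in>C \<inter> mspace X. mdist X x c \<le> r)}"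
    using disj coarsely_bounded_subset unfolding coarsely_disjoint_metric by blast
qed

lemma coarsely_disjoint_separation:
  assumes "coarsely_disjoint X A B"
  obtains C D where "C \<union> D = mspace X" "coarsely_disjoint X A C" "coarsely_disjoint X B D"
proof
  \<comment> \<open>A pointwise version of "at least as close to \<open>B\<close> as to
    \<open>A\<close>": without infima, neither attainment nor empty sets need separate
    treatment.\<close>
  let ?C = "{x \<in> mspace X. \<forall>a\<in>A \<inter> mspace X. \<exists>b\<in>B \<inter> mspace X. mdist X x b \<le> mdist X x a}"
  show "?C \<union> (mspace X - ?C) = mspace X"
    by blast
  show "coarsely_disjoint X A ?C"
    by (rule coarsely_disjoint_of_near[OF assms]) blast
  \<comment> \<open>A point outside \<open>?C\<close> has some \<open>a\<close> closer than every
    \<open>b\<close>, so the same lemma applies with \<open>A\<close> and \<open>B\<close>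
    exchanged.\<close>
  show "coarsely_disjoint X B (mspace X - ?C)"
    by (rule coarsely_disjoint_of_near[OF assms[unfolded coarsely_disjoint_sym[of X A]]])
      (use linorder_le_cases in blast)
qed

text \<open>Both halves of coarseness enter: the image of \<open>E\<close> is an entourage, so the
  points near both \<open>A\<close> and \<open>B\<close> in \<open>Y\<close> form a bounded set, and
  its preimage is bounded.\<close>

lemma coarsely_disjoint_vimage:
  assumes "coarse_map X Y f" "coarsely_disjoint Y A B"
  shows "coarsely_disjoint X (f -` A \<inter> mspace X) (f -` B \<inter> mspace X)"
  unfolding coarsely_disjoint_def
proof (intro allI impI)
  fix E
  assume E: "entourage X E"
  let ?E = "map_prod f f ` E"
  have "entourage Y ?E"
    using assms(1) E unfolding coarse_map_def by blast
  then have "coarsely_bounded X (f -` (?E\<inverse> `` A \<inter> ?E\<inverse> `` B) \<inter> mspace X)"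
    using assms unfolding coarse_map_def coarsely_disjoint_def by blast
  moreover have "E \<subseteq> mspace X \<times> mspace X"
    using E unfolding entourage_def by blast
  then have "E\<inverse> `` (f -` A \<inter> mspace X) \<inter> E\<inverse> `` (f -` B \<inter> mspace X)
      \<subseteq> f -` (?E\<inverse> `` A \<inter> ?E\<inverse> `` B) \<inter> mspace X"
    by (force simp: map_prod_def)
  ultimately show "coarsely_bounded X
      (E\<inverse> `` (f -` A \<inter> mspace X) \<inter> E\<inverse> `` (f -` B \<inter> mspace X))"
    by (rule coarsely_bounded_subset)
qed

section \<open>The equivalence relation \<lambda>\<close>

lemma asymptotically_alike_memI:
  assumes "(\<G>, \<F>) \<in> asymptotically_alike X" "C \<union> D = mspace X"
    and "A \<in> \<G>" "coarsely_disjoint X A C"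
  shows "D \<in> \<F>"
proof -
  have "C \<union> D \<in> \<F>"
    using assms(1,2) unfolding asymptotically_alike_def coarse_ultrafilters_def by simp
  then have "C \<in> \<F> \<or> D \<in> \<F>"
    using assms(1) unfolding asymptotically_alike_def coarse_ultrafilters_def by blast
  moreover have "C \<notin> \<F>"
    using assms(1,3,4) unfolding asymptotically_alike_def by blast
  ultimately show ?thesis
    by blast
qed

lemma equiv_asymptotically_alike:
  "equiv (coarse_ultrafilters X) (asymptotically_alike X)"
proof (rule equivI)
  show "asymptotically_alike X \<subseteq> coarse_ultrafilters X \<times> coarse_ultrafilters X"
    unfolding asymptotically_alike_def by blast
  show "refl_on (coarse_ultrafilters X) (asymptotically_alike X)"
    unfolding refl_on_def asymptotically_alike_def coarse_ultrafilters_def by blast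
  show "sym (asymptotically_alike X)"
    unfolding sym_def asymptotically_alike_def using coarsely_disjoint_sym by blast
  show "trans (asymptotically_alike X)"
  proof (rule transI)
    fix \<F> \<G> \<H>
    assume FG: "(\<F>, \<G>) \<in> asymptotically_alike X" and GH: "(\<G>, \<H>) \<in> asymptotically_alike X"
    have uf: "\<F> \<in> coarse_ultrafilters X" "\<G> \<in> coarse_ultrafilters X" "\<H> \<in> coarse_ultrafilters X"
      using FG GH unfolding asymptotically_alike_def by auto
    have "coarsely_close X A B" if AB: "A \<in> \<F>" "B \<in> \<H>" for A B
    proof
      assume "coarsely_disjoint X A B"
      then obtain C D where CD: "C \<union> D = mspace X" "coarsely_disjoint X A C" "coarsely_disjoint X B D"
        by (rule coarsely_disjoint_separation)
      \<comment> \<open>The middle ultrafilter thus contains a set far from \<open>B\<close>,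
        although \<open>B\<close> lies in an ultrafilter alike to it.\<close>
      have "D \<in> \<G>"
        using asymptotically_alike_memI[OF FG CD(1) AB(1) CD(2)] .
      then have "coarsely_close X D B"
        using GH AB(2) unfolding asymptotically_alike_def by blast
      then show False
        using CD(3) coarsely_disjoint_sym by blast
    qed
    with uf show "(\<F>, \<H>) \<in> asymptotically_alike X"
      unfolding asymptotically_alike_def by blast
  qed
qed

section \<open>Pushforward of coarse ultrafilters\<close>

lemma coarse_pushforward_close:
  assumes "coarse_map X Y f" "\<And>A B. \<lbrakk>A \<in> \<F>; B \<in> \<G>\<rbrakk> \<Longrightarrow> coarsely_close X A B"
    and "A \<in> coarse_pushforward X Y f \<F>" "B \<in> coarse_pushforward X Y f \<G>"
  shows "coarsely_close Y A B"
  using assms coarsely_disjoint_vimage unfolding coarse_pushforward_def by blast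

lemma coarse_pushforward_ultrafilter:
  assumes f: "coarse_map X Y f" and F: "\<F> \<in> coarse_ultrafilters X"
  shows "coarse_pushforward X Y f \<F> \<in> coarse_ultrafilters Y"
proof -
  have "f -` mspace Y \<inter> mspace X = mspace X"
    using f unfolding coarse_map_def by blast
  moreover have "f -` (A \<union> B) \<inter> mspace X = (f -` A \<inter> mspace X) \<union> (f -` B \<inter> mspace X)" for A B
    by blast
  moreover have "coarsely_close Y A B"
    if "A \<in> coarse_pushforward X Y f \<F>" "B \<in> coarse_pushforward X Y f \<F>" for A B
    using coarse_pushforward_close[OF f _ that] F unfolding coarse_ultrafilters_def by blast
  ultimately show ?thesis
    using F unfolding coarse_ultrafilters_def coarse_pushforward_def by auto
qed

lemma coarse_pushforward_alike:
  assumes f: "coarse_map X Y f" and FG: "(\<F>, \<G>) \<in> asymptotically_alike X"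
  shows "(coarse_pushforward X Y f \<F>, coarse_pushforward X Y f \<G>) \<in> asymptotically_alike Y"
proof -
  have "coarsely_close Y A B"
    if "A \<in> coarse_pushforward X Y f \<F>" "B \<in> coarse_pushforward X Y f \<G>" for A B
    using coarse_pushforward_close[OF f _ that] FG unfolding asymptotically_alike_def by blast
  then show ?thesis
    using FG coarse_pushforward_ultrafilter[OF f] unfolding asymptotically_alike_def by blast
qed

section \<open>Farness in the corona and the induced map\<close>

lemma corona_cl_classD:
  assumes "corona_class X \<F> \<in> corona_cl X A"
    and "coarsely_disjoint X A C" "C \<union> D = mspace X"
  shows "D \<in> \<F>"
proof -
  \<comment> \<open>Only some representative is known to contain \<open>A\<close>; passing to the
    given one costs replacing \<open>A\<close> by \<open>D\<close>.\<close>
  obtain \<G> where "(\<F>, \<G>) \<in> asymptotically_alike X" "A \<in> \<G>"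
    using assms(1) unfolding corona_cl_def by blast
  moreover from this have "(\<G>, \<F>) \<in> asymptotically_alike X"
    using equiv_asymptotically_alike[of X] by (blast elim: equivE dest: symD)
  ultimately show ?thesis
    using asymptotically_alike_memI assms(2,3) by blast
qed

text \<open>Witnesses lying in every representative are needed later: a representative that merely
  exists in a class of \<open>Y\<close> need not be a pushforward, so its members could not be
  pulled back.\<close>

lemma corona_far_classD:
  assumes "corona_far X P Q"
  obtains A B where "A \<subseteq> mspace X" "B \<subseteq> mspace X" "coarsely_disjoint X A B"
    and "\<And>\<F>. corona_class X \<F> \<in> P \<Longrightarrow> A \<in> \<F>"
    and "\<And>\<F>. corona_class X \<F> \<in> Q \<Longrightarrow> B \<in> \<F>"
proof -
  obtain A B where AB: "coarsely_disjoint X A B" "P \<subseteq> corona_cl X A" "Q \<subseteq> corona_cl X B"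
    using assms unfolding corona_far_def by blast
  obtain C D where CD: "C \<union> D = mspace X" "coarsely_disjoint X A C" "coarsely_disjoint X B D"
    using AB(1) by (rule coarsely_disjoint_separation)
  \<comment> \<open>Separating \<open>B\<close> from \<open>D\<close>, not from \<open>A\<close>,
    makes the two new witnesses \<open>D\<close> and \<open>D'\<close> far from each other.\<close>
  obtain C' D' where CD': "C' \<union> D' = mspace X" "coarsely_disjoint X B C'" "coarsely_disjoint X D D'"
    using CD(3) by (rule coarsely_disjoint_separation)
  show thesis
  proof
    show "D \<subseteq> mspace X" "D' \<subseteq> mspace X"
      using CD(1) CD'(1) by blast+
    show "coarsely_disjoint X D D'"
      by (rule CD'(3))
    show "D \<in> \<F>" if "corona_class X \<F> \<in> P" for \<F>
      using corona_cl_classD that AB(2) CD(1,2) by blast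
    show "D' \<in> \<F>" if "corona_class X \<F> \<in> Q" for \<F>
      using corona_cl_classD that AB(3) CD'(1,2) by blast
  qed
qed

theorem lemma24:
  fixes X :: "'a metric" and Y :: "'b metric" and f :: "'a \<Rightarrow> 'b"
  assumes "coarse_map X Y f"
  shows "\<exists>\<phi> \<in> corona X \<rightarrow> corona Y.
           (\<forall>\<F> \<in> coarse_ultrafilters X.
              coarse_pushforward X Y f \<F> \<in> coarse_ultrafilters Y \<and>
              \<phi> (corona_class X \<F>) = corona_class Y (coarse_pushforward X Y f \<F>)) \<and>
           (\<forall>P Q. P \<subseteq> corona X \<longrightarrow> Q \<subseteq> corona X \<longrightarrow>
              corona_close X P Q \<longrightarrow> corona_close Y (\<phi> ` P) (\<phi> ` Q))"
proof -
  let ?push = "coarse_pushforward X Y f"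
  \<comment> \<open>The union avoids choosing representatives: all of them yield the same class, so
    on a corona point it is that single class.\<close>
  define \<phi> where "\<phi> p = (\<Union>\<F>\<in>p. corona_class Y (?push \<F>))" for p
  have push: "?push \<F> \<in> coarse_ultrafilters Y" if "\<F> \<in> coarse_ultrafilters X" for \<F>
    using coarse_pushforward_ultrafilter[OF assms that] .
  have "(\<lambda>\<F>. corona_class Y (?push \<F>)) respects asymptotically_alike X"
    using coarse_pushforward_alike[OF assms] equiv_class_eq[OF equiv_asymptotically_alike]
    by (intro congruentI) blast
  then have \<phi>: "\<phi> (corona_class X \<F>) = corona_class Y (?push \<F>)"
    if "\<F> \<in> coarse_ultrafilters X" for \<F>
    unfolding \<phi>_def using UN_equiv_class[OF equiv_asymptotically_alike] that by blast
  have corona_rep: "\<exists>\<F>\<in>coarse_ultrafilters X. p = corona_class X \<F> \<and> \<F> \<in> p" if "p \<in> corona X" for p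
    using that equiv_class_self[OF equiv_asymptotically_alike[of X]]
    unfolding corona_def by (auto elim!: quotientE)
  have "\<phi> \<in> corona X \<rightarrow> corona Y"
  proof
    fix p
    assume "p \<in> corona X"
    with corona_rep \<phi> push show "\<phi> p \<in> corona Y"
      unfolding corona_def by (metis quotientI)
  qed
  \<comment> \<open>This is the contrapositive of preserving closeness: farness of the images is
    pulled back along \<open>f\<close>.\<close>
  moreover have "corona_far X P Q"
    if PQ: "P \<subseteq> corona X" "Q \<subseteq> corona X" and far: "corona_far Y (\<phi> ` P) (\<phi> ` Q)" for P Q
  proof -
    obtain A B where AB: "coarsely_disjoint Y A B"
      "\<And>\<G>. corona_class Y \<G> \<in> \<phi> ` P \<Longrightarrow> A \<in> \<G>"
      "\<And>\<G>. corona_class Y \<G> \<in> \<phi> ` Q \<Longrightarrow> B \<in> \<G>"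
      using corona_far_classD[OF far] by metis
    have cl: "R \<subseteq> corona_cl X (f -` C \<inter> mspace X)"
      if R: "R \<subseteq> corona X"
        and C: "\<And>\<G>. corona_class Y \<G> \<in> \<phi> ` R \<Longrightarrow> C \<in> \<G>" for R C
    proof
      fix p
      assume p: "p \<in> R"
      then obtain \<F> where F: "\<F> \<in> coarse_ultrafilters X" "p = corona_class X \<F>" "\<F> \<in> p"
        using R corona_rep by blast
      \<comment> \<open>By the definition of the pushforward this says that the preimage of
        \<open>C\<close> lies in \<open>\<F>\<close>, a representative of \<open>p\<close>.\<close>
      have "C \<in> ?push \<F>"
        using C \<phi>[OF F(1)] F(2) p by (metis imageI)
      then show "p \<in> corona_cl X (f -` C \<inter> mspace X)"
        using p R F(3) unfolding corona_cl_def coarse_pushforward_def by blast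
    qed
    show ?thesis
      unfolding corona_far_def
      using coarsely_disjoint_vimage[OF assms AB(1)] cl[OF PQ(1) AB(2)] cl[OF PQ(2) AB(3)]
      by (metis inf_le2)
  qed
  ultimately show ?thesis
    using push \<phi> by (intro bexI[of _ \<phi>] conjI ballI allI impI notI) simp_all
qed

end
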